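(* Let $G$ be a finite simple $d$-regular graph on $n$ vertices in which no two distinct vertices have the same neighbourhood, and suppose $G$ is a unit-distance graph in the plane. Then the incidence structure with point set $V(G)$ and block set $S(G)=\{N(v)\mid v\in V(G)\}$ (incidence being membership) is an $(n_d)$ configuration, and it is realizable as an isometric point-circle configuration in the plane.
   Context: $N(v)$ denotes the set of neighbours of $v$ in $G$. $G$ is a unit-distance graph in the plane if there is an injective map $p:V(G)\to\mathbb R^2$ with $|p(u)-p(v)|=1$ for every edge $uv$. An $(n_d)$ configuration (in this sense) is an incidence structure with $n$ points and $n$ blocks such that each block is incident with exactly $d$ points and each point with exactly $d$ blocks. A realization as an isometric point-circle configuration consists of distinct points of the plane assigned to the points and distinct circles of the plane, all of the same radius, assigned to the blocks, such that each point lies on the circle of every block it is incident with. *)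

theory Defs
  imports "HOL-Analysis.Analysis" "Graph_Theory.Pair_Digraph"
begin

text \<open>
  A finite simple graph is a \<open>pair_graph\<close>: finite vertex set, symmetric loopfree arc relation
  on it. Each edge \<open>uv\<close> is represented by the two arcs \<open>(u, v)\<close> and \<open>(v, u)\<close>, so the degree of
  a vertex is its \<open>out_degree\<close>.
\<close>

definition neighbourhood :: "'a pair_pre_digraph \<Rightarrow> 'a \<Rightarrow> 'a set" where
  "neighbourhood G v = {u. (v, u) \<in> parcs G}"

definition regular :: "'a pair_pre_digraph \<Rightarrow> nat \<Rightarrow> bool" where
  "regular G d \<longleftrightarrow> (\<forall>v \<in> pverts G. out_degree (with_proj G) v = d)"

definition unit_distance_graph :: "'a pair_pre_digraph \<Rightarrow> bool" where
  "unit_distance_graph G \<longleftrightarrow>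
     (\<exists>p :: 'a \<Rightarrow> real ^ 2. inj_on p (pverts G) \<and> (\<forall>(u, v) \<in> parcs G. dist (p u) (p v) = 1))"

text \<open>Only the restriction of \<open>incident\<close> to \<open>points\<close> and \<open>blocks\<close> is meaningful.\<close>

record ('p, 'b) incidence_structure =
  points :: "'p set"
  blocks :: "'b set"
  incident :: "'p \<Rightarrow> 'b \<Rightarrow> bool"

definition is_configuration :: "nat \<Rightarrow> nat \<Rightarrow> ('p, 'b) incidence_structure \<Rightarrow> bool" where
  "is_configuration n d S \<longleftrightarrow>
     finite (points S) \<and> card (points S) = n \<and>
     finite (blocks S) \<and> card (blocks S) = n \<and>
     (\<forall>b \<in> blocks S. card {x \<in> points S. incident S x b} = d) \<and>
     (\<forall>x \<in> points S. card {b \<in> blocks S. incident S x b} = d)"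

text \<open>
  The common radius \<open>r\<close> is positive, so that the circles are not degenerate. A point may also lie
  on circles of blocks it is not incident with.
\<close>

definition isometric_point_circle_realizable :: "('p, 'b) incidence_structure \<Rightarrow> bool" where
  "isometric_point_circle_realizable S \<longleftrightarrow>
     (\<exists>(p :: 'p \<Rightarrow> real ^ 2) (C :: 'b \<Rightarrow> (real ^ 2) set) r.
        inj_on p (points S) \<and> inj_on C (blocks S) \<and>
        r > 0 \<and> (\<forall>b \<in> blocks S. \<exists>c. C b = sphere c r) \<and>
        (\<forall>x \<in> points S. \<forall>b \<in> blocks S. incident S x b \<longrightarrow> p x \<in> C b))"

definition neighbourhood_structure :: "'a pair_pre_digraph \<Rightarrow> ('a, 'a set) incidence_structure" where
  "neighbourhood_structure G =
     \<lparr>points = pverts G, blocks = neighbourhood G ` pverts G, incident = (\<in>)\<rparr>"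

end

theory Submission
  imports Defs
begin

text \<open>Give the block \<open>neighbourhood G v\<close> the unit circle centred at
  \<open>p v\<close>: every neighbour of \<open>v\<close> is placed at distance 1 from
  \<open>p v\<close>, hence on that circle. As \<open>p\<close> is injective and a circle determines
  its centre (\<open>sphere_inject_centre\<close>), different blocks get different circles. The
  configuration counts rest on the symmetry of adjacency: the blocks through \<open>x\<close> are
  exactly the neighbourhoods of the neighbours of \<open>x\<close>. Regularity gives
  \<open>d\<close> such neighbours, and distinct vertices have distinct neighbourhoods, so there are
  \<open>d\<close> such blocks and as many blocks as vertices.\<close>

lemma sphere_inject_centre:
  fixes a b :: "'a::real_normed_vector"
  assumes "sphere a r = sphere b r" and "r > 0"
  shows "a = b"
proof (rule ccontr)
  assume "a \<noteq> b"
  \<comment> \<open>The point of the first sphere that is farthest from \<open>b\<close>, at distance \<open>norm (a - b) + r\<close>.\<close>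
  define x where "x = a + (r / norm (a - b)) *\<^sub>R (a - b)"
  have "x - b = (1 + r / norm (a - b)) *\<^sub>R (a - b)"
    by (simp add: x_def algebra_simps)
  then have "norm (x - b) = (1 + r / norm (a - b)) * norm (a - b)"
    using \<open>r > 0\<close> by simp
  also have "\<dots> = norm (a - b) + r"
    using \<open>a \<noteq> b\<close> by (simp add: field_simps)
  finally have "norm (x - b) = norm (a - b) + r" .
  moreover have "x \<in> sphere a r"
    using \<open>a \<noteq> b\<close> \<open>r > 0\<close> by (simp add: x_def dist_norm)
  then have "norm (x - b) = r"
    using assms(1) by (simp add: dist_norm norm_minus_commute)
  ultimately show False
    using \<open>a \<noteq> b\<close> by simp
qed

lemma card_neighbourhood: "card (neighbourhood G v) = out_degree (with_proj G) v"
proof -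
  have "out_arcs (with_proj G) v = Pair v ` neighbourhood G v"
    by (auto simp: out_arcs_def neighbourhood_def)
  then show ?thesis
    by (simp add: out_degree_def card_image inj_on_def)
qed

context pair_graph
begin

lemma neighbourhood_subset: "neighbourhood G v \<subseteq> pverts G"
  by (auto simp: neighbourhood_def dest: in_arcsD2)

text \<open>This self-duality of the incidence relation turns the count of blocks through a point
  into a vertex degree.\<close>

lemma neighbourhood_commute: "u \<in> neighbourhood G v \<longleftrightarrow> v \<in> neighbourhood G u"
  by (auto simp: neighbourhood_def intro: arcs_symmetric)

lemma is_configuration_neighbourhood_structure:
  assumes "regular G d" and "inj_on (neighbourhood G) (pverts G)"
  shows "is_configuration (card (pverts G)) d (neighbourhood_structure G)"
proof -
  have degree: "card (neighbourhood G v) = d" if "v \<in> pverts G" for v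
    using assms(1) that by (simp add: regular_def card_neighbourhood)
  have "card {x \<in> pverts G. x \<in> neighbourhood G v} = d" if "v \<in> pverts G" for v
  proof -
    have "{x \<in> pverts G. x \<in> neighbourhood G v} = neighbourhood G v"
      using neighbourhood_subset by blast
    then show ?thesis
      using degree that by simp
  qed
  moreover have "card {b \<in> neighbourhood G ` pverts G. x \<in> b} = d" if "x \<in> pverts G" for x
  proof -
    have "{b \<in> neighbourhood G ` pverts G. x \<in> b} = neighbourhood G ` neighbourhood G x"
      using neighbourhood_subset neighbourhood_commute by blast
    \<comment> \<open>No two neighbours of \<open>x\<close> yield the same block, so the image keeps
      all \<open>d\<close> elements.\<close>
    moreover have "inj_on (neighbourhood G) (neighbourhood G x)"
      using assms(2) neighbourhood_subset by (rule inj_on_subset)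
    ultimately show ?thesis
      using degree that by (simp add: card_image)
  qed
  ultimately show ?thesis
    using assms(2)
    by (auto simp: is_configuration_def neighbourhood_structure_def card_image)
qed

lemma isometric_point_circle_realizable_neighbourhood_structure:
  assumes "unit_distance_graph G" and inj: "inj_on (neighbourhood G) (pverts G)"
  shows "isometric_point_circle_realizable (neighbourhood_structure G)"
proof -
  obtain p :: "'a \<Rightarrow> real ^ 2"
    where p: "inj_on p (pverts G)"
      and unit: "\<And>u v. (u, v) \<in> parcs G \<Longrightarrow> dist (p u) (p v) = 1"
    using assms(1) unfolding unit_distance_graph_def by blast
  \<comment> \<open>A block is only a set of vertices, so its centre vertex has to be recovered from
    it; by \<open>inj\<close> that vertex is unique. The radius is the common edge length.\<close>
  define C where "C b = sphere (p (inv_into (pverts G) (neighbourhood G) b)) 1" for b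
  have C: "C (neighbourhood G v) = sphere (p v) 1" if "v \<in> pverts G" for v
    using that inj by (simp add: C_def)
  have "inj_on C (neighbourhood G ` pverts G)"
  proof (rule inj_onI, elim imageE)
    fix b b' u v
    assume "C b = C b'" and uv: "b = neighbourhood G u" "u \<in> pverts G"
      "b' = neighbourhood G v" "v \<in> pverts G"
    then have "sphere (p u) 1 = sphere (p v) 1"
      using C by simp
    then have "p u = p v"
      by (rule sphere_inject_centre) simp
    \<comment> \<open>Equal centres mean \<open>u = v\<close> by injectivity of \<open>p\<close>, so
      the two blocks coincide.\<close>
    then show "b = b'"
      using p uv by (auto dest: inj_onD)
  qed
  moreover have "p x \<in> C (neighbourhood G v)" if "v \<in> pverts G" "x \<in> neighbourhood G v" for x v
  proof -
    have "dist (p v) (p x) = 1"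
      using that unit by (simp add: neighbourhood_def)
    then show ?thesis
      using that C by simp
  qed
  ultimately show ?thesis
    unfolding isometric_point_circle_realizable_def neighbourhood_structure_def
    using p by (intro exI[of _ p] exI[of _ C] exI[of _ 1]) (auto simp: C_def)
qed

end

theorem theorem3p6:
  fixes G :: "'a pair_pre_digraph" and n d :: nat
  assumes "pair_graph G"
    and "card (pverts G) = n"
    and "regular G d"
    and "\<forall>u \<in> pverts G. \<forall>v \<in> pverts G. u \<noteq> v \<longrightarrow> neighbourhood G u \<noteq> neighbourhood G v"
    and "unit_distance_graph G"
  shows "is_configuration n d (neighbourhood_structure G) \<and>
         isometric_point_circle_realizable (neighbourhood_structure G)"
proof -
  interpret pair_graph G
    by (rule assms(1))
  have "inj_on (neighbourhood G) (pverts G)"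
    using assms(4) by (auto simp: inj_on_def)
  then show ?thesis
    using is_configuration_neighbourhood_structure
      isometric_point_circle_realizable_neighbourhood_structure assms(2,3,5) by blast
qed

end
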